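(* Let $\Pi\in\boldsymbol{\Pi}_{q,r}$. Then: (a) $\mathcal{Z}_r(\Pi)$ is nonempty and convex. (b) $\mathcal{Z}_r(\Pi)$ is bounded if and only if $\Pi_{22}<0$. (c) $\mathcal{Z}_r(\Pi)$ has nonempty interior (in $\mathbb{R}^{r\times q}$) if and only if $\Pi_{22}=0$ or $\Pi\mid\Pi_{22}>0$. (d) $\mathcal{Z}_r^+(\Pi)$ is nonempty if and only if $\Pi\mid\Pi_{22}>0$. (e) $\mathcal{Z}_r^0(\Pi)$ is nonempty if and only if $\operatorname{rank}\Pi_{22}\geq\operatorname{rank}(\Pi\mid\Pi_{22})$.
   Context: $\mathbb{S}^k$ denotes the real symmetric $k\times k$ matrices; for symmetric matrices, $A\ge 0$ ($A>0$) means positive semidefinite (definite), $A\le 0$, $A<0$ analogously, and $A\le B$ means $B-A\ge 0$. $A^\dagger$ is the Moore–Penrose pseudo-inverse. Any $\Pi\in\mathbb{S}^{q+r}$ is partitioned as $\Pi=\begin{bmatrix}\Pi_{11}&\Pi_{12}\\ \Pi_{21}&\Pi_{22}\end{bmatrix}$ with $\Pi_{11}\in\mathbb{S}^q$, $\Pi_{22}\in\mathbb{S}^r$, $\Pi_{21}=\Pi_{12}^\top$. The generalized Schur complement is $\Pi\mid\Pi_{22}:=\Pi_{11}-\Pi_{12}\Pi_{22}^\dagger\Pi_{21}$. The set $\boldsymbol{\Pi}_{q,r}$ consists of all $\Pi\in\mathbb{S}^{q+r}$ with $\Pi_{22}\le 0$, $\Pi\mid\Pi_{22}\ge 0$ and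 $\ker\Pi_{22}\subseteq\ker\Pi_{12}$. Define $\mathcal{Z}_r(\Pi)=\{Z\in\mathbb{R}^{r\times q}:\begin{bmatrix}I_q\\ Z\end{bmatrix}^\top\Pi\begin{bmatrix}I_q\\ Z\end{bmatrix}\ge 0\}$, $\mathcal{Z}_r^+(\Pi)$ the same with $>0$, and $\mathcal{Z}_r^0(\Pi)$ the same with $=0$. *)

theory Defs
  imports "HOL-Analysis.Analysis"
begin

text \<open>Matrices are HOL-Analysis matrices real^'n^'m (m rows, n columns).
  A symmetric (q+r)x(q+r) matrix has index type 'q + 'r; Inl indexes the first q
  coordinates, Inr the last r.\<close>

definition sym_mat :: "real^'n^'n \<Rightarrow> bool" where
  "sym_mat A \<longleftrightarrow> transpose A = A"

definition psd :: "real^'n^'n \<Rightarrow> bool" where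
  "psd A \<longleftrightarrow> (\<forall>x. 0 \<le> x \<bullet> (A *v x))"

definition pd :: "real^'n^'n \<Rightarrow> bool" where
  "pd A \<longleftrightarrow> (\<forall>x. x \<noteq> 0 \<longrightarrow> 0 < x \<bullet> (A *v x))"

definition nsd :: "real^'n^'n \<Rightarrow> bool" where
  "nsd A \<longleftrightarrow> psd (- A)"

definition nd :: "real^'n^'n \<Rightarrow> bool" where
  "nd A \<longleftrightarrow> pd (- A)"

text \<open>Moore--Penrose pseudo-inverse: the unique matrix satisfying the Penrose conditions.\<close>
definition mp_pinv :: "real^'n^'m \<Rightarrow> real^'m^'n" where
  "mp_pinv A = (THE X. A ** X ** A = A \<and> X ** A ** X = X \<and>
                       transpose (A ** X) = A ** X \<and> transpose (X ** A) = X ** A)"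

definition mker :: "real^'n^'m \<Rightarrow> (real^'n) set" where
  "mker A = {x. A *v x = 0}"

definition blk11 :: "real^('q::finite + 'r::finite)^('q + 'r) \<Rightarrow> real^'q^'q" where
  "blk11 P = (\<chi> i j. P $ Inl i $ Inl j)"
definition blk12 :: "real^('q::finite + 'r::finite)^('q + 'r) \<Rightarrow> real^'r^'q" where
  "blk12 P = (\<chi> i j. P $ Inl i $ Inr j)"
definition blk21 :: "real^('q::finite + 'r::finite)^('q + 'r) \<Rightarrow> real^'q^'r" where
  "blk21 P = (\<chi> i j. P $ Inr i $ Inl j)"
definition blk22 :: "real^('q::finite + 'r::finite)^('q + 'r) \<Rightarrow> real^'r^'r" where
  "blk22 P = (\<chi> i j. P $ Inr i $ Inr j)"

text \<open>Generalized Schur complement  Pi | Pi22 = Pi11 - Pi12 Pi22^dagger Pi21.\<close>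
definition schur :: "real^('q::finite + 'r::finite)^('q + 'r) \<Rightarrow> real^'q^'q" where
  "schur P = blk11 P - blk12 P ** mp_pinv (blk22 P) ** blk21 P"

definition PiSet :: "(real^('q::finite + 'r::finite)^('q + 'r)) set" where
  "PiSet = {P. sym_mat P \<and> nsd (blk22 P) \<and> psd (schur P) \<and>
               mker (blk22 P) \<subseteq> mker (blk12 P)}"

text \<open>The stacked matrix [I_q; Z] for Z an r x q matrix.\<close>
definition stackIZ :: "real^'q^'r \<Rightarrow> real^'q^('q::finite + 'r::finite)" where
  "stackIZ Z = (\<chi> k j. case k of Inl i \<Rightarrow> (if i = j then 1 else 0) | Inr i \<Rightarrow> Z $ i $ j)"

definition qform :: "real^('q::finite + 'r::finite)^('q + 'r) \<Rightarrow> real^'q^'r \<Rightarrow> real^'q^'q" where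
  "qform P Z = transpose (stackIZ Z) ** P ** stackIZ Z"

definition Zr :: "real^('q::finite + 'r::finite)^('q + 'r) \<Rightarrow> (real^'q^'r) set" where
  "Zr P = {Z. psd (qform P Z)}"
definition Zr_plus :: "real^('q::finite + 'r::finite)^('q + 'r) \<Rightarrow> (real^'q^'r) set" where
  "Zr_plus P = {Z. pd (qform P Z)}"
definition Zr_zero :: "real^('q::finite + 'r::finite)^('q + 'r) \<Rightarrow> (real^'q^'r) set" where
  "Zr_zero P = {Z. qform P Z = 0}"

end

theory Submission
  imports Defs
begin

text \<open>Because \<open>ker \<Pi>\<^sub>2\<^sub>2 \<subseteq> ker \<Pi>\<^sub>1\<^sub>2\<close>, the block \<open>\<Pi>\<^sub>1\<^sub>2\<close> factors through the
  projection \<open>\<Pi>\<^sub>2\<^sub>2 \<Pi>\<^sub>2\<^sub>2\<^sup>\<dagger>\<close>, and completing the square gives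
  \<open>[I; Z]\<^sup>T \<Pi> [I; Z] = S - (Z - Z\<^sub>0)\<^sup>T N (Z - Z\<^sub>0)\<close> with \<open>S = \<Pi> | \<Pi>\<^sub>2\<^sub>2 \<ge> 0\<close>,
  \<open>N = -\<Pi>\<^sub>2\<^sub>2 \<ge> 0\<close> and \<open>Z\<^sub>0 = -\<Pi>\<^sub>2\<^sub>2\<^sup>\<dagger> \<Pi>\<^sub>2\<^sub>1\<close>. So the three sets are translates of
  \<open>{W. W\<^sup>T N W \<le> S}\<close>, \<open>{W. W\<^sup>T N W < S}\<close> and \<open>{W. W\<^sup>T N W = S}\<close>. The first contains
  \<open>0\<close> and is convex because \<open>W \<mapsto> W\<^sup>T N W\<close> is matrix convex; it is bounded iff \<open>N\<close> is
  coercive, since a kernel vector of \<open>N\<close> gives a whole line of solutions; it has interior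
  iff \<open>N = 0\<close> or \<open>S > 0\<close>, since \<open>x\<^sup>T S x = 0\<close> forces \<open>N W x = 0\<close> for every member \<open>W\<close>.
  Finally \<open>W\<^sup>T N W = S\<close> is solvable iff \<open>rank S \<le> rank N\<close>: write \<open>N\<close> and \<open>S\<close> as sums of
  rank-one squares \<open>v v\<^sup>T\<close>, with the \<open>v\<close>'s of \<open>N\<close> independent, and map the one family onto
  the other by \<open>W\<^sup>T\<close>.\<close>

lemma inner_transpose_mv: "(transpose M *v x) \<bullet> (y::real^'n) = x \<bullet> (M *v y)"
  by (simp add: dot_lmul_matrix)

lemma inner_mv_symmetric:
  fixes M :: "real^'n^'n"
  assumes "transpose M = M"
  shows "y \<bullet> (M *v x) = x \<bullet> (M *v y)"
  using inner_transpose_mv[of M x y] assms by (simp add: inner_commute)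

lemma transpose_eq_if_inner_mv_symmetric:
  fixes M :: "real^'n^'n"
  assumes "\<And>x y. y \<bullet> (M *v x) = x \<bullet> (M *v y)"
  shows "transpose M = M"
  unfolding matrix_eq
  by (metis vector_eq_rdot inner_transpose_mv assms inner_commute)


section \<open>Moore--Penrose inverse of a symmetric matrix\<close>

definition penrose :: "real^'n^'m \<Rightarrow> real^'m^'n \<Rightarrow> bool" where
  "penrose A X \<longleftrightarrow> A ** X ** A = A \<and> X ** A ** X = X \<and>
     transpose (A ** X) = A ** X \<and> transpose (X ** A) = X ** A"

lemma penrose_unique:
  assumes "penrose A X" "penrose A Y"
  shows "X = Y"
proof -
  have X1: "A ** X ** A = A" and X2: "X ** A ** X = X"
    and X3: "transpose (A ** X) = A ** X" and X4: "transpose (X ** A) = X ** A"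
    and Y1: "A ** Y ** A = A" and Y2: "Y ** A ** Y = Y"
    and Y3: "transpose (A ** Y) = A ** Y" and Y4: "transpose (Y ** A) = Y ** A"
    using assms by (simp_all add: penrose_def)
  have "transpose A = transpose ((A ** Y) ** A)" using Y1 by simp
  also have "\<dots> = transpose A ** transpose (A ** Y)" by (rule matrix_transpose_mul)
  finally have TA1: "transpose A = transpose A ** (A ** Y)" using Y3 by simp
  have "transpose A = transpose (A ** (X ** A))" using X1 by (simp add: matrix_mul_assoc)
  also have "\<dots> = transpose (X ** A) ** transpose A" by (rule matrix_transpose_mul)
  finally have TA2: "transpose A = (X ** A) ** transpose A" using X4 by simp
  have "X = X ** (A ** X)" using X2 by (simp add: matrix_mul_assoc)
  also have "\<dots> = X ** (transpose X ** transpose A)" using X3 by (simp add: matrix_transpose_mul)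
  also have "\<dots> = X ** (transpose X ** (transpose A ** (A ** Y)))" using TA1 by simp
  also have "\<dots> = X ** (transpose X ** transpose A) ** A ** Y" by (simp add: matrix_mul_assoc)
  also have "\<dots> = X ** (A ** X) ** A ** Y" using X3 by (simp add: matrix_transpose_mul)
  also have "\<dots> = X ** A ** Y" using X2 by (simp add: matrix_mul_assoc)
  finally have XAY: "X = X ** A ** Y" .
  have "Y = (Y ** A) ** Y" using Y2 by simp
  also have "\<dots> = (transpose A ** transpose Y) ** Y" using Y4 by (metis matrix_transpose_mul)
  also have "\<dots> = ((X ** A) ** transpose A ** transpose Y) ** Y" using TA2 by simp
  also have "\<dots> = X ** A ** (transpose A ** transpose Y) ** Y" by (simp add: matrix_mul_assoc)
  also have "\<dots> = X ** A ** (Y ** A) ** Y" using Y4 by (metis matrix_transpose_mul)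
  also have "\<dots> = X ** A ** Y" using Y2 by (metis matrix_mul_assoc)
  finally show ?thesis using XAY by simp
qed

lemma symmetric_range_retraction:
  fixes A :: "real^'n^'n"
  assumes symA: "transpose A = A"
  obtains g where "linear g" "\<And>x. g x \<in> range ((*v) A)"
    "\<And>v. v \<in> range ((*v) A) \<Longrightarrow> g (A *v v) = v"
    "\<And>y. y \<in> range ((*v) A) \<Longrightarrow> A *v g y = y"
proof -
  define R where "R = range ((*v) A)"
  have subR: "subspace R" unfolding R_def
    by (rule linear_subspace_image[OF matrix_vector_mul_linear subspace_UNIV])
  have ker_orth_R: "z \<bullet> y = 0" if "A *v z = 0" "y \<in> R" for z y
    using that inner_mv_symmetric[OF symA, of _ z] unfolding R_def by auto
  have "inj_on ((*v) A) R"
  proof (rule inj_onI)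
    fix u v assume uv: "u \<in> R" "v \<in> R" "A *v u = A *v v"
    have "A *v (u - v) = 0" using uv(3) by (simp add: matrix_vector_mult_diff_distrib)
    moreover have "u - v \<in> R" using subR uv by (simp add: subspace_diff)
    ultimately have "(u - v) \<bullet> (u - v) = 0" using ker_orth_R by blast
    then show "u = v" by simp
  qed
  then obtain g where g: "g ` UNIV \<subseteq> R" "linear g" "\<And>v. v \<in> R \<Longrightarrow> g (A *v v) = v"
    using linear_exists_left_inverse_on[OF matrix_vector_mul_linear subR] by blast
  \<comment> \<open>Split \<open>x\<close> orthogonally along \<open>R\<close>: the component orthogonal to \<open>R\<close> lies in the kernel.\<close>
  have "\<exists>v\<in>R. A *v x = A *v v" for x
  proof -
    obtain y z where yz: "y \<in> span R" "\<And>w. w \<in> span R \<Longrightarrow> orthogonal z w" "x = y + z"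
      using orthogonal_subspace_decomp_exists by blast
    have spR: "span R = R" using subR by (simp add: span_eq_iff)
    have "A *v (A *v z) \<in> R" unfolding R_def by auto
    then have "z \<bullet> (A *v (A *v z)) = 0" using yz(2) spR by (auto simp: orthogonal_def)
    then have "A *v z = 0" using inner_mv_symmetric[OF symA, of "A *v z" z] by simp
    then show ?thesis using yz spR by (auto simp: matrix_vector_right_distrib)
  qed
  then have "A *v g y = y" if "y \<in> R" for y
    using that g(3) unfolding R_def by (metis rangeE)
  with g show thesis using that unfolding R_def by blast
qed

lemma penrose_exists_symmetric:
  fixes A :: "real^'n^'n"
  assumes symA: "transpose A = A"
  shows "\<exists>X. penrose A X"
proof -
  let ?R = "range ((*v) A)"
  obtain g where g: "linear g" "\<And>x. g x \<in> ?R" "\<And>v. v \<in> ?R \<Longrightarrow> g (A *v v) = v"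
    "\<And>y. y \<in> ?R \<Longrightarrow> A *v g y = y"
    using symmetric_range_retraction[OF symA] by blast
  define G where "G = matrix g"
  have Gx: "G *v x = g x" for x unfolding G_def using g(1) by (simp add: matrix_works)
  \<comment> \<open>\<open>P = G A\<close> is the orthogonal projection onto the range of \<open>A\<close>.\<close>
  define P where "P = G ** A"
  have Px: "P *v x = g (A *v x)" for x by (simp add: P_def Gx matrix_vector_mul_assoc[symmetric])
  have Pker: "A *v (x - P *v x) = 0" for x
    using g(4)[of "A *v x"] by (simp add: Px matrix_vector_mult_diff_distrib)
  have Porth: "(x - P *v x) \<bullet> y = 0" if "y \<in> ?R" for x y
    using that Pker inner_mv_symmetric[OF symA] by auto
  have symP: "transpose P = P"
  proof (rule transpose_eq_if_inner_mv_symmetric)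
    fix x y
    have "y \<bullet> (P *v x) = (P *v y) \<bullet> (P *v x)" "x \<bullet> (P *v y) = (P *v x) \<bullet> (P *v y)"
      using Porth[of "P *v _"] by (simp_all add: Px g(2) inner_diff_left)
    then show "y \<bullet> (P *v x) = x \<bullet> (P *v y)" by (simp add: inner_commute)
  qed
  have AP: "A ** P = A" unfolding matrix_eq
    using Pker by (simp add: matrix_vector_mul_assoc[symmetric] matrix_vector_mult_diff_distrib)
  have PA: "P ** A = A"
    using arg_cong[OF AP, of transpose] by (simp add: matrix_transpose_mul symP symA)
  have PG: "P ** G = G" unfolding matrix_eq
    by (simp add: matrix_vector_mul_assoc[symmetric] Gx Px g(2,3))
  define X where "X = G ** P"
  have AX: "A ** X = P" unfolding matrix_eq X_def
    by (simp add: matrix_vector_mul_assoc[symmetric] Gx Px g(2,4))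
  have XA: "X ** A = P" unfolding X_def by (metis PA P_def matrix_mul_assoc)
  have "X ** A ** X = X" by (metis PG XA X_def matrix_mul_assoc)
  then have "penrose A X" by (simp add: penrose_def AX XA PA symP)
  then show ?thesis ..
qed

lemma mp_pinv_symmetric:
  fixes A :: "real^'n^'n"
  assumes "transpose A = A"
  shows "A ** mp_pinv A ** A = A" "transpose (A ** mp_pinv A) = A ** mp_pinv A"
proof -
  obtain X where X: "penrose A X" using penrose_exists_symmetric[OF assms] ..
  have "mp_pinv A = X" unfolding mp_pinv_def penrose_def[symmetric]
    using X penrose_unique by blast
  then show "A ** mp_pinv A ** A = A" "transpose (A ** mp_pinv A) = A ** mp_pinv A"
    using X by (simp_all add: penrose_def)
qed

section \<open>Block structure and completing the square\<close>

lemma matrix_add_rdistrib: "((A::real^'n^'m) + B) ** C = A ** C + B ** C"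
  by (vector matrix_matrix_mult_def sum.distrib distrib_right)

lemma matrix_neg_left: "(- (A::real^'n^'m)) ** C = - (A ** C)"
  by (vector matrix_matrix_mult_def sum_negf)

lemma matrix_neg_right: "(C::real^'n^'m) ** (- A) = - (C ** A)"
  by (vector matrix_matrix_mult_def sum_negf)

lemma transpose_add: "transpose ((A::real^'n^'m) + B) = transpose A + transpose B"
  by (simp add: transpose_def vec_eq_iff)

lemma transpose_diff: "transpose ((A::real^'n^'m) - B) = transpose A - transpose B"
  by (simp add: transpose_def vec_eq_iff)

lemma transpose_neg: "transpose (- (A::real^'n^'m)) = - transpose A"
  by (simp add: transpose_def vec_eq_iff)

definition stack_vec :: "real^'q \<Rightarrow> real^'r \<Rightarrow> real^('q::finite + 'r::finite)" where
  "stack_vec u w = (\<chi> k. case k of Inl i \<Rightarrow> u $ i | Inr i \<Rightarrow> w $ i)"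

lemma sum_UNIV_Plus:
  "sum f (UNIV :: ('a::finite + 'b::finite) set) = sum (f \<circ> Inl) UNIV + sum (f \<circ> Inr) UNIV"
  using sum.Plus[of "UNIV::'a set" "UNIV::'b set" f] by simp

lemma stackIZ_mv: "stackIZ Z *v x = stack_vec x (Z *v x)"
  by (simp add: vec_eq_iff stackIZ_def matrix_vector_mult_def stack_vec_def sum_UNIV_Plus
      if_distrib if_distribR sum.delta cong: if_cong split: sum.split)

lemma vm_stackIZ: "stack_vec a b v* stackIZ Z = a + b v* Z"
  by (simp add: vec_eq_iff stackIZ_def vector_matrix_mult_def sum_UNIV_Plus stack_vec_def
      if_distrib if_distribR sum.delta' cong: if_cong)

lemma mv_stack_vec:
  "P *v stack_vec u w =
     stack_vec (blk11 P *v u + blk12 P *v w) (blk21 P *v u + blk22 P *v w)"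
  by (simp add: vec_eq_iff stack_vec_def matrix_vector_mult_def sum_UNIV_Plus
      blk11_def blk12_def blk21_def blk22_def split: sum.split)

lemma qform_blocks:
  "qform P Z = blk11 P + blk12 P ** Z + transpose Z ** blk21 P + transpose Z ** blk22 P ** Z"
  unfolding matrix_eq qform_def
  by (simp add: matrix_vector_mul_assoc[symmetric] stackIZ_mv mv_stack_vec vm_stackIZ
      matrix_vector_mult_add_rdistrib matrix_vector_right_distrib algebra_simps)

lemma blocks_symmetric:
  fixes P :: "real^('q::finite + 'r::finite)^('q + 'r)"
  assumes "transpose P = P"
  shows "transpose (blk11 P) = blk11 P" "blk21 P = transpose (blk12 P)"
    "transpose (blk22 P) = blk22 P"
proof -
  have "P $ j $ i = P $ i $ j" for i j
    using arg_cong[OF assms, of "\<lambda>M. M $ i $ j"] by (simp add: transpose_def)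
  then show "transpose (blk11 P) = blk11 P" "blk21 P = transpose (blk12 P)"
    "transpose (blk22 P) = blk22 P"
    by (simp_all add: vec_eq_iff transpose_def blk11_def blk12_def blk21_def blk22_def)
qed

lemma factor_through_range_projection:
  fixes A X :: "real^'r^'r" and B :: "real^'r^'q"
  assumes symA: "transpose A = A" and AXA: "A ** X ** A = A"
    and symAX: "transpose (A ** X) = A ** X"
    and ker: "\<And>v. A *v v = 0 \<Longrightarrow> B *v v = 0"
  shows "B ** A ** X = B"
proof -
  have "transpose ((A ** X) ** A) = transpose A ** transpose (A ** X)"
    by (rule matrix_transpose_mul)
  then have "A ** (A ** X) = A" by (simp only: AXA symA symAX)
  then have "A *v (y - (A ** X) *v y) = 0" for y
    by (simp add: matrix_vector_mult_diff_distrib matrix_vector_mul_assoc)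
  then have "B *v (y - (A ** X) *v y) = 0" for y by (rule ker)
  then show ?thesis unfolding matrix_eq
    by (simp add: matrix_vector_mult_diff_distrib matrix_vector_mul_assoc matrix_mul_assoc)
qed

lemma completion_of_squares:
  fixes A X :: "real^'r^'r" and B :: "real^'r^'q" and D :: "real^'q^'q" and Z :: "real^'q^'r"
  assumes symA: "transpose A = A" and AXA: "A ** X ** A = A"
    and symAX: "transpose (A ** X) = A ** X"
    and ker: "\<And>v. A *v v = 0 \<Longrightarrow> B *v v = 0"
  shows "D + B ** Z + transpose Z ** transpose B + transpose Z ** A ** Z =
      (D - B ** X ** transpose B) + transpose (Z + X ** transpose B) ** A ** (Z + X ** transpose B)"
    and "transpose (B ** X ** transpose B) = B ** X ** transpose B"
proof -
  have BAX: "B ** A ** X = B" by (rule factor_through_range_projection[OF assms])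
  have XA: "transpose X ** A = A ** X" using symAX by (simp add: matrix_transpose_mul symA)
  have BXA: "B ** transpose X ** A = B" by (metis XA BAX matrix_mul_assoc)
  have AXB: "A ** X ** transpose B = transpose B"
    using arg_cong[OF BAX, of transpose] XA by (simp add: matrix_transpose_mul symA matrix_mul_assoc)
  have "transpose (Z + X ** transpose B) ** A ** (Z + X ** transpose B) =
      transpose Z ** A ** Z + transpose Z ** (A ** X ** transpose B)
      + (B ** transpose X ** A) ** Z + (B ** transpose X ** A) ** X ** transpose B"
    by (simp add: transpose_add matrix_transpose_mul matrix_add_rdistrib matrix_add_ldistrib
        matrix_mul_assoc)
  also have "\<dots> = transpose Z ** A ** Z + transpose Z ** transpose B + B ** Z + B ** X ** transpose B"
    by (simp only: AXB BXA)
  finally show "D + B ** Z + transpose Z ** transpose B + transpose Z ** A ** Z =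
      (D - B ** X ** transpose B) + transpose (Z + X ** transpose B) ** A ** (Z + X ** transpose B)"
    by (simp add: algebra_simps)
  have "B ** X ** transpose B = (B ** transpose X ** A) ** X ** transpose B" by (simp only: BXA)
  also have "\<dots> = B ** transpose X ** transpose B" by (metis AXB matrix_mul_assoc)
  finally show "transpose (B ** X ** transpose B) = B ** X ** transpose B"
    by (simp add: matrix_transpose_mul matrix_mul_assoc)
qed

section \<open>Positive semidefinite quadratic forms\<close>

lemma inner_mv_add_scaleR:
  fixes N :: "real^'n^'n"
  assumes "transpose N = N"
  shows "(x + t *\<^sub>R z) \<bullet> (N *v (x + t *\<^sub>R z)) =
    x \<bullet> (N *v x) + 2 * t * (z \<bullet> (N *v x)) + t\<^sup>2 * (z \<bullet> (N *v z))"
  using inner_mv_symmetric[OF assms, of z x]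
  by (simp add: matrix_vector_right_distrib matrix_vector_mult_scaleR inner_add_left
      inner_add_right power2_eq_square algebra_simps)

lemma psd_form_eq_0_imp_mv_eq_0:
  fixes N :: "real^'n^'n"
  assumes symN: "transpose N = N" and psdN: "psd N" and x: "x \<bullet> (N *v x) = 0"
  shows "N *v x = 0"
proof (rule ccontr)
  define z where "z = N *v x"
  define a where "a = z \<bullet> (N *v z)"
  define b where "b = z \<bullet> z"
  assume "N *v x \<noteq> 0"
  then have b: "b > 0" by (simp add: b_def z_def)
  have a: "a \<ge> 0" using psdN psd_def a_def by blast
  define t where "t = - b / (a + 1)"
  have "t < 0" using a b by (simp add: t_def)
  moreover have "t * a \<ge> - b"
    using a b by (simp add: t_def field_simps)
  then have "2 * b + t * a > 0" using b by linarith
  ultimately have "t * (2 * b + t * a) < 0" by (rule mult_neg_pos)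
  moreover have "0 \<le> (x + t *\<^sub>R z) \<bullet> (N *v (x + t *\<^sub>R z))" using psdN psd_def by blast
  moreover have "z \<bullet> (N *v x) = b" by (simp add: z_def b_def)
  then have "(x + t *\<^sub>R z) \<bullet> (N *v (x + t *\<^sub>R z)) = t * (2 * b + t * a)"
    using inner_mv_add_scaleR[OF symN, of x t z] x
    by (simp add: a_def power2_eq_square algebra_simps)
  ultimately show False by simp
qed

lemma psd_cauchy_schwarz:
  fixes N :: "real^'n^'n"
  assumes symN: "transpose N = N" and psdN: "psd N" and y: "y \<bullet> (N *v y) > 0"
  shows "(x \<bullet> (N *v y))\<^sup>2 \<le> (x \<bullet> (N *v x)) * (y \<bullet> (N *v y))"
proof -
  define b where "b = y \<bullet> (N *v x)"
  define c where "c = y \<bullet> (N *v y)"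
  define s where "s = - b / c"
  have sb: "2 * s * b + s\<^sup>2 * c = - b\<^sup>2 / c"
    using y by (simp add: s_def c_def power2_eq_square field_simps)
  have "0 \<le> (x + s *\<^sub>R y) \<bullet> (N *v (x + s *\<^sub>R y))" using psdN psd_def by blast
  also have "\<dots> = x \<bullet> (N *v x) + 2 * s * b + s\<^sup>2 * c"
    using inner_mv_add_scaleR[OF symN, of x s y] by (simp only: b_def c_def)
  also have "\<dots> = x \<bullet> (N *v x) - b\<^sup>2 / c" using sb by simp
  finally have "b\<^sup>2 / c \<le> x \<bullet> (N *v x)" by simp
  then show ?thesis
    using y inner_mv_symmetric[OF symN, of y x] by (simp add: b_def c_def pos_divide_le_eq)
qed

lemma psd_form_convex:
  fixes N :: "real^'n^'n"
  assumes symN: "transpose N = N" and psdN: "psd N" and u: "0 \<le> u" "u \<le> 1"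
  shows "(u *\<^sub>R a + (1 - u) *\<^sub>R b) \<bullet> (N *v (u *\<^sub>R a + (1 - u) *\<^sub>R b)) \<le>
    u * (a \<bullet> (N *v a)) + (1 - u) * (b \<bullet> (N *v b))"
proof -
  define c where "c = (a - b) \<bullet> (N *v b)"
  define d where "d = (a - b) \<bullet> (N *v (a - b))"
  have "d \<ge> 0" using psdN psd_def d_def by blast
  have "u *\<^sub>R a + (1 - u) *\<^sub>R b = b + u *\<^sub>R (a - b)" by (simp add: algebra_simps)
  then have "(u *\<^sub>R a + (1 - u) *\<^sub>R b) \<bullet> (N *v (u *\<^sub>R a + (1 - u) *\<^sub>R b)) =
      b \<bullet> (N *v b) + 2 * u * c + u\<^sup>2 * d"
    using inner_mv_add_scaleR[OF symN, of b u "a - b"] by (simp only: c_def d_def)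
  moreover have "a \<bullet> (N *v a) = b \<bullet> (N *v b) + 2 * c + d"
    using inner_mv_add_scaleR[OF symN, of b 1 "a - b"] by (simp add: c_def d_def)
  moreover have "u\<^sup>2 * d \<le> u * d" using u \<open>d \<ge> 0\<close>
    by (simp add: power2_eq_square mult_right_le_one_le mult_right_mono)
  ultimately show ?thesis by (simp add: algebra_simps)
qed

lemma pd_form_coercive:
  fixes N :: "real^'n^'n"
  assumes "pd N"
  obtains m where "m > 0" "\<And>y. m * (norm y)\<^sup>2 \<le> y \<bullet> (N *v y)"
proof -
  let ?f = "\<lambda>y. y \<bullet> (N *v y)"
  have "axis undefined 1 \<in> sphere (0::real^'n) 1" by simp
  moreover have "continuous_on (sphere (0::real^'n) 1) ?f" by (intro continuous_intros)
  ultimately obtain y0 where y0: "y0 \<in> sphere 0 1" "\<And>y. y \<in> sphere 0 1 \<Longrightarrow> ?f y0 \<le> ?f y"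
    using continuous_attains_inf[OF compact_sphere] by blast
  have "?f y0 * (norm y)\<^sup>2 \<le> ?f y" for y
  proof (cases "y = 0")
    case False
    define u where "u = (1 / norm y) *\<^sub>R y"
    have "u \<in> sphere 0 1" using False by (simp add: u_def)
    then have "?f y0 \<le> ?f u" by (rule y0(2))
    moreover have "y = norm y *\<^sub>R u" using False by (simp add: u_def)
    then have "?f y = (norm y)\<^sup>2 * ?f u"
      by (metis inner_scaleR_left inner_scaleR_right matrix_vector_mult_scaleR
          mult.assoc power2_eq_square)
    ultimately show ?thesis by (simp add: mult.commute mult_right_mono)
  qed simp
  moreover have "y0 \<noteq> 0" using y0(1) by auto
  then have "?f y0 > 0" using assms pd_def by blast
  ultimately show thesis using that by blast
qed

lemma inner_mv_le_onorm:
  fixes N :: "real^'n^'n"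
  shows "y \<bullet> (N *v y) \<le> onorm ((*v) N) * (norm y)\<^sup>2"
proof -
  have "y \<bullet> (N *v y) \<le> norm y * norm (N *v y)" by (rule norm_cauchy_schwarz)
  also have "\<dots> \<le> norm y * (onorm ((*v) N) * norm y)"
    by (intro mult_left_mono onorm[OF matrix_vector_mul_bounded_linear]) simp
  finally show ?thesis by (simp add: power2_eq_square mult.commute mult.left_commute)
qed

lemma inner_mv_congruence:
  fixes W :: "real^'a^'b" and N :: "real^'b^'b"
  shows "x \<bullet> ((S - transpose W ** N ** W) *v x) = x \<bullet> (S *v x) - (W *v x) \<bullet> (N *v (W *v x))"
proof -
  have "x \<bullet> (transpose W *v y) = (W *v x) \<bullet> y" for y
    using inner_transpose_mv[of W y x] by (simp only: inner_commute)
  then show ?thesis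
    by (simp only: matrix_vector_mult_diff_rdistrib inner_diff_right
        matrix_vector_mul_assoc[symmetric])
qed

section \<open>Rank-one decompositions\<close>

definition outer_prod :: "real^'a \<Rightarrow> real^'b \<Rightarrow> real^'b^'a" where
  "outer_prod v w = (\<chi> i j. v $ i * w $ j)"

lemma outer_prod_mv: "outer_prod v w *v x = (w \<bullet> x) *\<^sub>R v"
  by (simp add: outer_prod_def vec_eq_iff matrix_vector_mult_def inner_vec_def
      sum_distrib_left algebra_simps)

lemma transpose_outer_prod_self: "transpose (outer_prod v v) = outer_prod v v"
  by (simp add: outer_prod_def transpose_def vec_eq_iff mult.commute)

lemma congruence_outer_prod:
  fixes W :: "real^'q^'r"
  shows "transpose W ** outer_prod v v ** W = outer_prod (transpose W *v v) (transpose W *v v)"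
  unfolding matrix_eq
proof
  fix x
  have "v \<bullet> (W *v x) = (transpose W *v v) \<bullet> x" using inner_transpose_mv[of W v x] by simp
  then show "(transpose W ** outer_prod v v ** W) *v x =
      outer_prod (transpose W *v v) (transpose W *v v) *v x"
    by (simp only: matrix_vector_mul_assoc[symmetric] outer_prod_mv matrix_vector_mult_scaleR)
qed

lemma congruence_sum_outer_prod:
  fixes W :: "real^'q^'r"
  shows "transpose W ** sum_list (map (\<lambda>v. outer_prod v v) vs) ** W =
    sum_list (map (\<lambda>v. outer_prod (transpose W *v v) (transpose W *v v)) vs)"
  by (induction vs) (simp_all add: matrix_add_ldistrib matrix_add_rdistrib congruence_outer_prod)

lemma psd_deflation:
  fixes N :: "real^'n^'n"
  assumes symN: "transpose N = N" and psdN: "psd N" and "N \<noteq> 0"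
  obtains v where "v \<in> range ((*v) N)" "v \<notin> range ((*v) (N - outer_prod v v))"
    "range ((*v) (N - outer_prod v v)) \<subseteq> range ((*v) N)"
    "transpose (N - outer_prod v v) = N - outer_prod v v" "psd (N - outer_prod v v)"
proof -
  obtain e where "N *v e \<noteq> 0" using \<open>N \<noteq> 0\<close> by (metis matrix_eq matrix_vector_mult_0)
  define c where "c = e \<bullet> (N *v e)"
  have "c \<ge> 0" using psdN psd_def c_def by blast
  moreover have "c \<noteq> 0"
    using psd_form_eq_0_imp_mv_eq_0[OF symN psdN, of e] \<open>N *v e \<noteq> 0\<close> unfolding c_def by blast
  ultimately have c: "c > 0" by simp
  \<comment> \<open>Removing \<open>v v\<^sup>T\<close> keeps \<open>N\<close> semidefinite (Cauchy--Schwarz) and kills \<open>e\<close>.\<close>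
  define v where "v = (1 / sqrt c) *\<^sub>R (N *v e)"
  define N' where "N' = N - outer_prod v v"
  have N'x: "N' *v x = N *v x - (v \<bullet> x) *\<^sub>R v" for x
    by (simp add: N'_def matrix_vector_mult_diff_rdistrib outer_prod_mv)
  have symN': "transpose N' = N'"
    using symN by (simp add: N'_def transpose_diff transpose_outer_prod_self)
  have ve: "v \<bullet> e = sqrt c"
    using c by (simp add: v_def c_def inner_commute real_div_sqrt)
  have psdN': "psd N'" unfolding psd_def
  proof
    fix x
    have "(v \<bullet> x)\<^sup>2 = (x \<bullet> (N *v e))\<^sup>2 / c"
      using c by (simp add: v_def inner_commute power_divide)
    also have "\<dots> \<le> x \<bullet> (N *v x)"
      using psd_cauchy_schwarz[OF symN psdN, of e x] c by (simp add: c_def pos_divide_le_eq)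
    finally show "0 \<le> x \<bullet> (N' *v x)"
      by (simp add: N'x inner_diff_right power2_eq_square inner_commute)
  qed
  have "range ((*v) N') \<subseteq> range ((*v) N)"
  proof
    fix y assume "y \<in> range ((*v) N')"
    then obtain x where "y = N' *v x" by auto
    then have "y = N *v (x - ((v \<bullet> x) / sqrt c) *\<^sub>R e)"
      by (simp add: N'x matrix_vector_mult_diff_distrib matrix_vector_mult_scaleR v_def)
    then show "y \<in> range ((*v) N)" by auto
  qed
  moreover have "v \<notin> range ((*v) N')"
  proof
    assume "v \<in> range ((*v) N')"
    then obtain y where y: "v = N' *v y" by auto
    have "N' *v e = N *v e - sqrt c *\<^sub>R v" by (simp only: N'x ve)
    then have "N' *v e = 0" using c by (simp add: v_def)
    then have "v \<bullet> e = 0" using inner_mv_symmetric[OF symN', of y e] by (simp add: y inner_commute)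
    then show False using ve c by simp
  qed
  moreover have "v \<in> range ((*v) N)"
    by (rule range_eqI[of _ _ "(1 / sqrt c) *\<^sub>R e"]) (simp add: v_def matrix_vector_mult_scaleR)
  ultimately show thesis using that symN' psdN' unfolding N'_def by blast
qed

lemma psd_sum_outer_prod:
  fixes N :: "real^'n^'n"
  assumes "transpose N = N" "psd N"
  shows "\<exists>vs. distinct vs \<and> independent (set vs) \<and> set vs \<subseteq> range ((*v) N) \<and>
           N = sum_list (map (\<lambda>v. outer_prod v v) vs)"
  using assms
proof (induction "rank N" arbitrary: N rule: less_induct)
  case less
  show ?case
  proof (cases "N = 0")
    case True
    then show ?thesis by (intro exI[of _ "[]"]) (auto simp: independent_empty)
  next
    case False
    obtain v where v: "v \<in> range ((*v) N)" "v \<notin> range ((*v) (N - outer_prod v v))"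
      "range ((*v) (N - outer_prod v v)) \<subseteq> range ((*v) N)"
      "transpose (N - outer_prod v v) = N - outer_prod v v" "psd (N - outer_prod v v)"
      using psd_deflation[OF less.prems False] by blast
    let ?R = "range ((*v) (N - outer_prod v v))"
    have sub: "subspace ?R" "subspace (range ((*v) N))"
      by (rule linear_subspace_image[OF matrix_vector_mul_linear subspace_UNIV])+
    have "dim ?R < dim (range ((*v) N))"
      using v(1-3) by (intro dim_psubset) (auto simp: span_eq_iff[THEN iffD2, OF sub(1)]
          span_eq_iff[THEN iffD2, OF sub(2)])
    then obtain vs where vs: "distinct vs" "independent (set vs)" "set vs \<subseteq> ?R"
      "N - outer_prod v v = sum_list (map (\<lambda>v. outer_prod v v) vs)"
      using less.hyps[OF _ v(4,5)] by (auto simp: rank_dim_range)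
    have "v \<notin> span (set vs)" using span_minimal[OF vs(3) sub(1)] v(2) by blast
    then have "independent (set (v # vs))" "distinct (v # vs)"
      using vs(1,2) span_base[of v "set vs"] by (auto simp: independent_insertI)
    moreover have "set (v # vs) \<subseteq> range ((*v) N)" using vs(3) v(1,3) by auto
    moreover have "N = sum_list (map (\<lambda>v. outer_prod v v) (v # vs))"
      using vs(4) by (simp add: algebra_simps)
    ultimately show ?thesis by blast
  qed
qed

lemma sum_list_scaleR_in_span: "sum_list (map (\<lambda>v. f v *\<^sub>R v) vs) \<in> span (set vs)"
proof (induction vs)
  case (Cons a vs)
  then have "sum_list (map (\<lambda>v. f v *\<^sub>R v) vs) \<in> span (set (a # vs))"
    using span_mono[of "set vs" "set (a # vs)"] by auto
  then show ?case by (simp add: span_add span_base span_mul)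
qed (simp add: span_zero)

lemma psd_sum_outer_prod_rank:
  fixes N :: "real^'n^'n"
  assumes "transpose N = N" "psd N"
  shows "\<exists>vs. distinct vs \<and> independent (set vs) \<and>
           N = sum_list (map (\<lambda>v. outer_prod v v) vs) \<and> length vs = rank N"
proof -
  obtain vs where vs: "distinct vs" "independent (set vs)" "set vs \<subseteq> range ((*v) N)"
    "N = sum_list (map (\<lambda>v. outer_prod v v) vs)"
    using psd_sum_outer_prod[OF assms] by blast
  have "N *v x = sum_list (map (\<lambda>v. (v \<bullet> x) *\<^sub>R v) vs)" for x
    unfolding vs(4) by (induction vs) (simp_all add: matrix_vector_mult_add_rdistrib outer_prod_mv)
  then have "range ((*v) N) \<subseteq> span (set vs)" using sum_list_scaleR_in_span by auto
  moreover have "span (set vs) \<subseteq> range ((*v) N)"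
    by (rule span_minimal[OF vs(3) linear_subspace_image[OF matrix_vector_mul_linear subspace_UNIV]])
  ultimately have "rank N = card (set vs)"
    by (metis rank_dim_range dim_span dim_span_eq_card_independent vs(2) subset_antisym)
  then show ?thesis using vs distinct_card by fastforce
qed

section \<open>The sets of \<open>W\<close> with \<open>W\<^sup>T N W \<le> S\<close>\<close>

lemma bounded_if_entries_bounded:
  fixes F :: "(real^'a^'b) set"
  assumes "\<And>W i j. W \<in> F \<Longrightarrow> \<bar>W $ i $ j\<bar> \<le> c j"
  shows "bounded F"
  unfolding bounded_iff
proof (intro exI ballI)
  fix W assume "W \<in> F"
  have "norm W \<le> (\<Sum>i\<in>UNIV. norm (W $ i))"
    unfolding norm_vec_def by (rule L2_set_le_sum) simp
  also have "\<dots> \<le> (\<Sum>i\<in>UNIV. \<Sum>j\<in>UNIV. \<bar>W $ i $ j\<bar>)"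
    by (rule sum_mono) (rule norm_le_l1_cart)
  also have "\<dots> \<le> (\<Sum>i\<in>(UNIV::'b set). \<Sum>j\<in>UNIV. c j)"
    using assms \<open>W \<in> F\<close> by (intro sum_mono) auto
  finally show "norm W \<le> (\<Sum>i\<in>(UNIV::'b set). \<Sum>j\<in>UNIV. c j)" .
qed

lemma norm_mv_le:
  fixes M :: "real^'n^'m"
  shows "norm (M *v x) \<le> real CARD('m) * real CARD('n) * norm M * norm x"
proof -
  have "\<bar>M $ i $ j\<bar> \<le> norm M" for i j
    using component_le_norm_cart[of "M $ i" j] Finite_Cartesian_Product.norm_nth_le[where x=M and i=i]
    by linarith
  then have "onorm ((*v) M) \<le> real CARD('m) * real CARD('n) * norm M"
    by (rule onorm_le_matrix_component)
  then show ?thesis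
    using onorm[OF matrix_vector_mul_bounded_linear, of M x]
    by (meson mult_right_mono norm_ge_zero order_trans)
qed

lemma convex_psd_congruence_gap:
  fixes N :: "real^'r^'r" and S :: "real^'q^'q"
  assumes symN: "transpose N = N" and psdN: "psd N"
  shows "convex {W :: real^'q^'r. psd (S - transpose W ** N ** W)}"
proof (rule convexI, unfold mem_Collect_eq)
  fix W1 W2 :: "real^'q^'r" and u v :: real
  assume W: "psd (S - transpose W1 ** N ** W1)" "psd (S - transpose W2 ** N ** W2)"
    and uv: "0 \<le> u" "0 \<le> v" "u + v = 1"
  show "psd (S - transpose (u *\<^sub>R W1 + v *\<^sub>R W2) ** N ** (u *\<^sub>R W1 + v *\<^sub>R W2))"
    unfolding psd_def inner_mv_congruence
  proof
    fix x
    let ?q = "\<lambda>y. y \<bullet> (N *v y)"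
    have "v = 1 - u" using uv(3) by simp
    then have "(u *\<^sub>R W1 + v *\<^sub>R W2) *v x = u *\<^sub>R (W1 *v x) + (1 - u) *\<^sub>R (W2 *v x)"
      by (simp add: matrix_vector_mult_add_rdistrib scaleR_matrix_vector_assoc)
    then have "?q ((u *\<^sub>R W1 + v *\<^sub>R W2) *v x) \<le> u * ?q (W1 *v x) + (1 - u) * ?q (W2 *v x)"
      using psd_form_convex[OF symN psdN] uv by simp
    also have "\<dots> \<le> u * (x \<bullet> (S *v x)) + (1 - u) * (x \<bullet> (S *v x))"
      using W uv unfolding psd_def inner_mv_congruence
      by (intro add_mono mult_left_mono) (auto simp: algebra_simps)
    finally show "0 \<le> x \<bullet> (S *v x) - ?q ((u *\<^sub>R W1 + v *\<^sub>R W2) *v x)"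
      by (simp add: algebra_simps)
  qed
qed

lemma unbounded_psd_congruence_gap:
  fixes N :: "real^'r^'r" and S :: "real^'q^'q"
  assumes symN: "transpose N = N" and psdN: "psd N" and psdS: "psd S" and "\<not> pd N"
  shows "\<not> bounded {W :: real^'q^'r. psd (S - transpose W ** N ** W)}"
proof
  assume bd: "bounded {W :: real^'q^'r. psd (S - transpose W ** N ** W)}"
  obtain v where v: "v \<noteq> 0" "\<not> 0 < v \<bullet> (N *v v)" using \<open>\<not> pd N\<close> unfolding pd_def by blast
  then have "N *v v = 0"
    using psd_form_eq_0_imp_mv_eq_0[OF symN psdN] psdN psd_def by (metis order_less_le)
  define E :: "real^'q^'r" where "E = outer_prod v (axis undefined 1)"
  have inset: "psd (S - transpose (t *\<^sub>R E) ** N ** (t *\<^sub>R E))" for t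
    using psdS \<open>N *v v = 0\<close>
    by (simp add: psd_def inner_mv_congruence E_def outer_prod_mv
        scaleR_matrix_vector_assoc[symmetric] matrix_vector_mult_scaleR)
  have "E *v axis undefined 1 = v" by (simp add: E_def outer_prod_mv)
  then have "norm E > 0" using v(1) by auto
  obtain K where "\<And>W. psd (S - transpose W ** N ** W) \<Longrightarrow> norm W \<le> K"
    using bd unfolding bounded_iff by auto
  then have "norm (((\<bar>K\<bar> + 1) / norm E) *\<^sub>R E) \<le> K" using inset by blast
  then show False using \<open>norm E > 0\<close> by simp
qed

lemma bounded_psd_congruence_gap:
  fixes N :: "real^'r^'r" and S :: "real^'q^'q"
  assumes "pd N"
  shows "bounded {W :: real^'q^'r. psd (S - transpose W ** N ** W)}"
proof -
  obtain m where m: "m > 0" "\<And>y. m * (norm y)\<^sup>2 \<le> y \<bullet> (N *v y)"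
    using pd_form_coercive[OF assms] by blast
  have "\<bar>W $ i $ j\<bar> \<le> sqrt (axis j 1 \<bullet> (S *v axis j 1) / m)"
    if "psd (S - transpose W ** N ** W)" for W :: "real^'q^'r" and i j
  proof -
    have "m * (norm (W *v axis j 1))\<^sup>2 \<le> axis j 1 \<bullet> (S *v axis j 1)"
      using that m(2)[of "W *v axis j 1"] unfolding psd_def inner_mv_congruence
      by (metis diff_ge_0_iff_ge order_trans)
    then have "(norm (W *v axis j 1))\<^sup>2 \<le> axis j 1 \<bullet> (S *v axis j 1) / m"
      using m(1) by (simp add: le_divide_eq mult.commute)
    then have "norm (W *v axis j 1) \<le> sqrt (axis j 1 \<bullet> (S *v axis j 1) / m)" by (rule real_le_rsqrt)
    moreover have "\<bar>W $ i $ j\<bar> \<le> norm (W *v axis j 1)"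
      using component_le_norm_cart[of "W *v axis j 1" i]
      by (simp add: matrix_vector_mult_def axis_def if_distrib if_distribR sum.delta' cong: if_cong)
    ultimately show ?thesis by linarith
  qed
  then show ?thesis by (intro bounded_if_entries_bounded) blast
qed

lemma interior_psd_congruence_gap_empty:
  fixes N :: "real^'r^'r" and S :: "real^'q^'q"
  assumes symN: "transpose N = N" and psdN: "psd N" and psdS: "psd S"
    and "N \<noteq> 0" and "\<not> pd S"
  shows "interior {W :: real^'q^'r. psd (S - transpose W ** N ** W)} = {}"
proof (rule ccontr)
  obtain x y where x: "x \<noteq> 0" "\<not> 0 < x \<bullet> (S *v x)" and y: "N *v y \<noteq> 0"
    using assms(4,5) unfolding pd_def by (metis matrix_eq matrix_vector_mult_0)
  have "x \<bullet> (S *v x) = 0" using x(2) psdS psd_def by (metis order_less_le)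
  \<comment> \<open>Members \<open>W\<close> must map \<open>x\<close> into \<open>ker N\<close>; a perturbation along \<open>y x\<^sup>T\<close> breaks this.\<close>
  then have ker: "N *v (W *v x) = 0" if "psd (S - transpose W ** N ** W)" for W
    using that psd_form_eq_0_imp_mv_eq_0[OF symN psdN, of "W *v x"] psdN
    unfolding psd_def inner_mv_congruence by (metis diff_0 neg_0_le_iff_le order_antisym)
  assume "interior {W :: real^'q^'r. psd (S - transpose W ** N ** W)} \<noteq> {}"
  then obtain W e where "e > 0" and ball: "ball W e \<subseteq> {W. psd (S - transpose W ** N ** W)}"
    unfolding ex_in_conv[symmetric] mem_interior by blast
  define E :: "real^'q^'r" where "E = outer_prod y x"
  have "E *v x = (x \<bullet> x) *\<^sub>R y" by (simp add: E_def outer_prod_mv)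
  then have "E \<noteq> 0" using x(1) y by auto
  define t where "t = e / (2 * norm E)"
  have "t > 0" using \<open>e > 0\<close> \<open>E \<noteq> 0\<close> by (simp add: t_def)
  have "dist W (W + t *\<^sub>R E) < e" using \<open>e > 0\<close> \<open>E \<noteq> 0\<close> by (simp add: dist_norm t_def)
  then have "W + t *\<^sub>R E \<in> ball W e" "W \<in> ball W e" using \<open>e > 0\<close> by auto
  then have "N *v ((W + t *\<^sub>R E) *v x) = 0" "N *v (W *v x) = 0"
    using ball ker by (meson mem_Collect_eq subsetD)+
  then have "(t * (x \<bullet> x)) *\<^sub>R (N *v y) = 0"
    using \<open>E *v x = (x \<bullet> x) *\<^sub>R y\<close>
    by (simp add: matrix_vector_mult_add_rdistrib matrix_vector_right_distrib
        scaleR_matrix_vector_assoc[symmetric] matrix_vector_mult_scaleR)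
  then show False using \<open>t > 0\<close> x(1) y by simp
qed

lemma zero_in_interior_psd_congruence_gap:
  fixes N :: "real^'r^'r" and S :: "real^'q^'q"
  assumes "pd S"
  shows "0 \<in> interior {W :: real^'q^'r. psd (S - transpose W ** N ** W)}"
proof -
  obtain m where m: "m > 0" "\<And>y. m * (norm y)\<^sup>2 \<le> y \<bullet> (S *v y)"
    using pd_form_coercive[OF assms] by blast
  define K where "K = real CARD('r) * real CARD('q)"
  define L where "L = onorm ((*v) N)"
  have "K > 0" by (simp add: K_def)
  have "L \<ge> 0" unfolding L_def by (rule onorm_pos_le[OF matrix_vector_mul_bounded_linear])
  define d where "d = sqrt (m / (L + 1)) / K"
  have "d > 0" using m(1) \<open>K > 0\<close> \<open>L \<ge> 0\<close> by (simp add: d_def)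
  moreover have "ball 0 d \<subseteq> {W :: real^'q^'r. psd (S - transpose W ** N ** W)}"
  proof (intro subsetI CollectI)
    fix W :: "real^'q^'r" assume "W \<in> ball 0 d"
    then have "K * norm W \<le> sqrt (m / (L + 1))"
      using \<open>K > 0\<close> by (simp add: d_def field_simps)
    then have "(K * norm W)\<^sup>2 \<le> (sqrt (m / (L + 1)))\<^sup>2"
      using \<open>K > 0\<close> by (intro power_mono) simp_all
    then have KW: "(K * norm W)\<^sup>2 \<le> m / (L + 1)" using \<open>L \<ge> 0\<close> m(1) by simp
    show "psd (S - transpose W ** N ** W)" unfolding psd_def inner_mv_congruence
    proof
      fix x
      have "(W *v x) \<bullet> (N *v (W *v x)) \<le> L * (norm (W *v x))\<^sup>2"
        unfolding L_def by (rule inner_mv_le_onorm)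
      also have "\<dots> \<le> L * (K * norm W * norm x)\<^sup>2"
        using norm_mv_le[of W x] \<open>L \<ge> 0\<close> by (intro mult_left_mono power_mono) (simp_all add: K_def)
      also have "\<dots> = L * (K * norm W)\<^sup>2 * (norm x)\<^sup>2" by (simp add: power_mult_distrib)
      also have "\<dots> \<le> L * (m / (L + 1)) * (norm x)\<^sup>2"
        using KW \<open>L \<ge> 0\<close> by (intro mult_right_mono mult_left_mono) auto
      also have "\<dots> \<le> m * (norm x)\<^sup>2"
        using \<open>L \<ge> 0\<close> m(1) by (intro mult_right_mono) (simp_all add: field_simps)
      also have "\<dots> \<le> x \<bullet> (S *v x)" by (rule m(2))
      finally show "0 \<le> x \<bullet> (S *v x) - (W *v x) \<bullet> (N *v (W *v x))" by simp
    qed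
  qed
  ultimately show ?thesis unfolding mem_interior by blast
qed

lemma pd_congruence_gap_nonempty_iff:
  fixes N :: "real^'r^'r" and S :: "real^'q^'q"
  assumes psdN: "psd N"
  shows "{W :: real^'q^'r. pd (S - transpose W ** N ** W)} \<noteq> {} \<longleftrightarrow> pd S"
proof
  assume "{W :: real^'q^'r. pd (S - transpose W ** N ** W)} \<noteq> {}"
  then obtain W :: "real^'q^'r" where "pd (S - transpose W ** N ** W)" by blast
  show "pd S" unfolding pd_def
  proof (intro allI impI)
    fix x :: "real^'q" assume "x \<noteq> 0"
    then have "0 < x \<bullet> (S *v x) - (W *v x) \<bullet> (N *v (W *v x))"
      using \<open>pd (S - transpose W ** N ** W)\<close> unfolding pd_def inner_mv_congruence by blast
    moreover have "0 \<le> (W *v x) \<bullet> (N *v (W *v x))" using psdN psd_def by blast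
    ultimately show "0 < x \<bullet> (S *v x)" by linarith
  qed
next
  assume "pd S"
  then have "0 \<in> {W :: real^'q^'r. pd (S - transpose W ** N ** W)}" by simp
  then show "{W :: real^'q^'r. pd (S - transpose W ** N ** W)} \<noteq> {}" by blast
qed

lemma rank_uminus: "rank (- (M::real^'n^'m)) = rank M"
proof -
  have "(*v) (- M) = (*v) M \<circ> uminus"
    by (simp add: fun_eq_iff vec_eq_iff matrix_vector_mult_def sum_negf)
  then have "range ((*v) (- M)) = (*v) M ` range uminus" by (simp only: image_comp)
  also have "range (uminus :: real^'n \<Rightarrow> real^'n) = UNIV" by (rule surjI[of _ uminus]) simp
  finally show ?thesis by (simp add: rank_dim_range)
qed

lemma linear_map_list_exists:
  fixes vs :: "'a::euclidean_space list" and us :: "'b::real_vector list"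
  assumes "distinct vs" "independent (set vs)" "length us = length vs"
  obtains T where "linear T" "map T vs = us"
proof -
  obtain T where T: "linear T" "\<And>x. x \<in> set vs \<Longrightarrow> T x = the (map_of (zip vs us) x)"
    using linear_independent_extend[OF assms(2), of "\<lambda>x. the (map_of (zip vs us) x)"] by blast
  have "map T vs = us"
  proof (rule nth_equalityI)
    fix i assume "i < length (map T vs)"
    then have i: "i < length vs" by simp
    then have "T (vs ! i) = the (map_of (zip vs us) (vs ! i))" using T(2) by simp
    also have "\<dots> = us ! i" using map_of_zip_nth[of vs us i] assms(1,3) i by simp
    finally show "map T vs ! i = us ! i" using i by simp
  qed (simp add: assms(3))
  with T(1) show thesis by (rule that)
qed

lemma congruence_solvable_iff_rank_le:
  fixes N :: "real^'r^'r" and S :: "real^'q^'q"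
  assumes symN: "transpose N = N" and psdN: "psd N" and symS: "transpose S = S" and psdS: "psd S"
  shows "(\<exists>W :: real^'q^'r. transpose W ** N ** W = S) \<longleftrightarrow> rank S \<le> rank N"
proof
  assume "\<exists>W :: real^'q^'r. transpose W ** N ** W = S"
  then obtain W :: "real^'q^'r" where "S = transpose W ** N ** W" by metis
  then have "rank S \<le> rank (transpose W ** N)" by (metis rank_mul_le_left)
  also have "\<dots> \<le> rank N" by (rule rank_mul_le_right)
  finally show "rank S \<le> rank N" .
next
  assume rk: "rank S \<le> rank N"
  obtain vs where vs: "distinct vs" "independent (set vs)"
    "N = sum_list (map (\<lambda>v. outer_prod v v) vs)" "length vs = rank N"
    using psd_sum_outer_prod_rank[OF symN psdN] by blast
  obtain us where us: "S = sum_list (map (\<lambda>v. outer_prod v v) us)" "length us = rank S"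
    using psd_sum_outer_prod_rank[OF symS psdS] by blast
  \<comment> \<open>Pad the decomposition of \<open>S\<close> with zero vectors to the length of that of \<open>N\<close>, then send
     the independent \<open>vs\<close> to these vectors by a linear map \<open>T = W\<^sup>T\<close>.\<close>
  define us' where "us' = us @ replicate (length vs - length us) 0"
  have len: "length us' = length vs" using rk us(2) vs(4) by (simp add: us'_def)
  have "sum_list (map (\<lambda>v. outer_prod v v) (replicate n (0::real^'q))) = 0" for n
    by (induction n) (simp_all add: outer_prod_def zero_vec_def)
  then have Sus': "S = sum_list (map (\<lambda>v. outer_prod v v) us')" by (simp add: us'_def us(1))
  obtain T where T: "linear T" "map T vs = us'"
    using linear_map_list_exists[OF vs(1,2) len] by blast
  define W :: "real^'q^'r" where "W = transpose (matrix T)"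
  have WT: "transpose W *v v = T v" for v using T(1) by (simp add: W_def matrix_works)
  have "transpose W ** N ** W = sum_list (map (\<lambda>v. outer_prod (T v) (T v)) vs)"
    unfolding vs(3) congruence_sum_outer_prod WT ..
  also have "\<dots> = sum_list (map (\<lambda>v. outer_prod v v) (map T vs))" by (simp add: comp_def)
  also have "\<dots> = S" using Sus' T(2) by simp
  finally have "transpose W ** N ** W = S" .
  then show "\<exists>W :: real^'q^'r. transpose W ** N ** W = S" by blast
qed

section \<open>Reduction to the generalized Schur complement\<close>

lemma Collect_diff_eq_translation: "{x. Q (x - a)} = (+) a ` {x. Q x}" for a :: "'a::ab_group_add"
  by (auto simp: image_iff intro!: exI[where x="x - a" for x])

lemma bounded_translation_iff: "bounded ((+) a ` S) \<longleftrightarrow> bounded S" for S :: "'a::real_normed_vector set"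
  using bounded_translation[of "(+) a ` S" "- a"] bounded_translation[of S a]
  by (auto simp: image_image)

lemma PiSet_completion_of_squares:
  fixes P :: "real^('q::finite + 'r::finite)^('q + 'r)"
  assumes "P \<in> PiSet"
  defines "Z0 \<equiv> - (mp_pinv (blk22 P) ** blk21 P)"
  shows "qform P Z = schur P - transpose (Z - Z0) ** (- blk22 P) ** (Z - Z0)"
    and "transpose (schur P) = schur P"
proof -
  let ?A = "blk22 P" and ?B = "blk12 P" and ?X = "mp_pinv (blk22 P)"
  have symP: "transpose P = P" and ker: "\<And>v. ?A *v v = 0 \<Longrightarrow> ?B *v v = 0"
    using assms(1) by (auto simp: PiSet_def sym_mat_def mker_def)
  note blk = blocks_symmetric[OF symP]
  note pinv = mp_pinv_symmetric[OF blk(3)]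
  have "qform P Z = blk11 P + ?B ** Z + transpose Z ** transpose ?B + transpose Z ** ?A ** Z"
    by (simp add: qform_blocks blk(2))
  also have "\<dots> = schur P + transpose (Z + ?X ** transpose ?B) ** ?A ** (Z + ?X ** transpose ?B)"
    unfolding schur_def blk(2) by (rule completion_of_squares(1)[OF blk(3) pinv ker])
  finally show "qform P Z = schur P - transpose (Z - Z0) ** (- ?A) ** (Z - Z0)"
    by (simp add: Z0_def blk(2) matrix_neg_left matrix_neg_right)
  show "transpose (schur P) = schur P"
    using completion_of_squares(2)[OF blk(3) pinv ker] blk(1)
    by (simp add: schur_def blk(2) transpose_diff)
qed

lemma Zr_translates:
  fixes P :: "real^('q::finite + 'r::finite)^('q + 'r)"
  assumes "P \<in> PiSet"
  defines "Z0 \<equiv> - (mp_pinv (blk22 P) ** blk21 P)"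
  shows "Zr P = (+) Z0 ` {W. psd (schur P - transpose W ** (- blk22 P) ** W)}"
    and "Zr_plus P = (+) Z0 ` {W. pd (schur P - transpose W ** (- blk22 P) ** W)}"
    and "Zr_zero P = (+) Z0 ` {W. schur P - transpose W ** (- blk22 P) ** W = 0}"
  unfolding Zr_def Zr_plus_def Zr_zero_def PiSet_completion_of_squares(1)[OF assms(1)]
    Z0_def[symmetric]
  by (rule Collect_diff_eq_translation)+

theorem mainTheorem1:
  fixes P :: "real^('q::finite + 'r::finite)^('q + 'r)"
  assumes "P \<in> PiSet"
  shows "(Zr P \<noteq> {} \<and> convex (Zr P))
       \<and> (bounded (Zr P) \<longleftrightarrow> nd (blk22 P))
       \<and> (interior (Zr P) \<noteq> {} \<longleftrightarrow> (blk22 P = 0 \<or> pd (schur P)))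
       \<and> (Zr_plus P \<noteq> {} \<longleftrightarrow> pd (schur P))
       \<and> (Zr_zero P \<noteq> {} \<longleftrightarrow> rank (blk22 P) \<ge> rank (schur P))"
proof -
  let ?S = "schur P" and ?N = "- blk22 P"
  have symN: "transpose ?N = ?N" and psdN: "psd ?N" and symS: "transpose ?S = ?S"
    and psdS: "psd ?S"
    using assms PiSet_completion_of_squares(2)[OF assms] blocks_symmetric(3)[of P]
    by (auto simp: PiSet_def sym_mat_def nsd_def transpose_neg)
  have "{W. psd (?S - transpose W ** ?N ** W)} \<noteq> {}" using psdS by (auto intro!: exI[of _ 0])
  moreover have "bounded {W. psd (?S - transpose W ** ?N ** W)} \<longleftrightarrow> pd ?N"
    using unbounded_psd_congruence_gap[OF symN psdN psdS] bounded_psd_congruence_gap by blast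
  moreover have "interior {W. psd (?S - transpose W ** ?N ** W)} \<noteq> {} \<longleftrightarrow> blk22 P = 0 \<or> pd ?S"
    using interior_psd_congruence_gap_empty[OF symN psdN psdS] psdS
      zero_in_interior_psd_congruence_gap[of ?S ?N] by (cases "blk22 P = 0") auto
  moreover have "{W. ?S - transpose W ** ?N ** W = 0} \<noteq> {} \<longleftrightarrow> rank ?S \<le> rank (blk22 P)"
    using congruence_solvable_iff_rank_le[OF symN psdN symS psdS] by (auto simp: rank_uminus) metis
  ultimately show ?thesis
    unfolding Zr_translates[OF assms] image_is_empty convex_translation_eq
      bounded_translation_iff interior_translation nd_def
    using convex_psd_congruence_gap[OF symN psdN] pd_congruence_gap_nonempty_iff[OF psdN]
    by blast
qed

end
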